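(* Let $n\ge 2$, let $0\le \alpha_1<\alpha_2<\dots<\alpha_n$ be integers, and let $x_1,\dots,x_n$ be positive integers. For $0\le k\le n$ put $p_k=\sum_{i=1}^k x_i$ and $q_k=\sum_{i=1}^k \alpha_i x_i$ (so $p_0=q_0=0$). Suppose that for every $k$ with $1\le k\le n$, $$q_{k-1}-\frac{p_{k-1}(p_{k-1}-1)}{2}\ge 0\quad\text{and}\quad 1\le x_k\le \frac{\bigl(2(\alpha_k-p_{k-1})+1\bigr)+\sqrt{\bigl(2(\alpha_k-p_{k-1})+1\bigr)^2+8\bigl(q_{k-1}-p_{k-1}(p_{k-1}-1)/2\bigr)}}{2},$$ with equality in the right-hand inequality when $k=n$. Then there exists a nonnegative integer $f$ with $f\le (2\alpha_n+1)/2$ such that $$(2\alpha_n+1-2f)\,f=\sum_{i=1}^{n-1}(\alpha_n-\alpha_i)\,x_i .$$ *)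

theory Defs
  imports Complex_Main
begin

definition psum :: "(nat \<Rightarrow> int) \<Rightarrow> nat \<Rightarrow> int" where
  "psum x k = (\<Sum>i=1..k. x i)"

definition qsum :: "(nat \<Rightarrow> int) \<Rightarrow> (nat \<Rightarrow> int) \<Rightarrow> nat \<Rightarrow> int" where
  "qsum \<alpha> x k = (\<Sum>i=1..k. \<alpha> i * x i)"

definition excess :: "(nat \<Rightarrow> int) \<Rightarrow> (nat \<Rightarrow> int) \<Rightarrow> nat \<Rightarrow> real" where
  "excess \<alpha> x k =
     real_of_int (qsum \<alpha> x k) - real_of_int (psum x k) * (real_of_int (psum x k) - 1) / 2"

definition xbound :: "(nat \<Rightarrow> int) \<Rightarrow> (nat \<Rightarrow> int) \<Rightarrow> nat \<Rightarrow> real" where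
  "xbound \<alpha> x k =
     (let b = 2 * (real_of_int (\<alpha> k) - real_of_int (psum x (k - 1))) + 1
      in (b + sqrt (b\<^sup>2 + 8 * excess \<alpha> x (k - 1))) / 2)"

end

theory Submission imports Defs begin

text \<open>Squaring the equality for \<open>x n\<close> gives \<open>P * (2 * \<alpha> n + 1 - P) = 2 * S\<close>, where \<open>P = psum x n\<close>
  and \<open>S\<close> is the target sum. The two factors have opposite parity and are nonnegative
  because \<open>P > 0\<close> and \<open>S \<ge> 0\<close>; half of the even one is \<open>f\<close>.\<close>

lemma half_of_even_factor:
  fixes P a S :: int
  assumes eq: "P * (2 * a + 1 - P) = 2 * S" and "0 < P" and "0 \<le> S"
  shows "\<exists>f. 0 \<le> f \<and> 2 * f \<le> 2 * a + 1 \<and> (2 * a + 1 - 2 * f) * f = S"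
proof -
  have le: "P \<le> 2 * a + 1"
    using assms zero_le_mult_iff[of P "2 * a + 1 - P"] by auto
  show ?thesis
  proof (cases "even P")
    case True
    then obtain f where P: "P = 2 * f" by (elim evenE)
    have "(2 * a + 1 - 2 * f) * f = S"
      using eq unfolding P by (simp add: algebra_simps)
    then show ?thesis using P \<open>0 < P\<close> le by (intro exI[of _ f]) auto
  next
    case False
    then have "even (2 * a + 1 - P)" by simp
    \<comment> \<open>The factors sum to \<open>2 * a + 1\<close>, so naming either one
      \<open>2 * f\<close> makes the other \<open>2 * a + 1 - 2 * f\<close>. Here \<open>le\<close>
      gives \<open>0 \<le> f\<close> and \<open>0 < P\<close> gives the upper bound; in the even
      case these roles are swapped.\<close>
    then obtain f where f: "2 * a + 1 - P = 2 * f" by (elim evenE)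
    then have P: "P = 2 * a + 1 - 2 * f" by simp
    have "(2 * a + 1 - 2 * f) * f = S"
      using eq unfolding P by (simp add: algebra_simps)
    then show ?thesis using P \<open>0 < P\<close> le by (intro exI[of _ f]) auto
  qed
qed

text \<open>\<open>xbound \<alpha> x k\<close> is the larger root of
  \<open>X\<^sup>2 - b * X - 2 * excess \<alpha> x (k - 1)\<close>, with \<open>b\<close> as in its
  definition. Shifting the variable by \<open>psum x (k - 1)\<close> absorbs the quadratic term of
  the excess, which leaves a product in \<open>psum x k\<close>.\<close>

lemma xbound_quadratic:
  fixes \<alpha> x :: "nat \<Rightarrow> int" and k :: nat
  assumes "1 \<le> k" and "0 \<le> excess \<alpha> x (k - 1)" and eq: "real_of_int (x k) = xbound \<alpha> x k"
  shows "psum x k * (2 * \<alpha> k + 1 - psum x k) = 2 * (\<Sum>i=1..k-1. (\<alpha> k - \<alpha> i) * x i)"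
proof -
  define p q where "p = psum x (k - 1)" and "q = qsum \<alpha> x (k - 1)"
  define b where "b = 2 * (real_of_int (\<alpha> k) - real_of_int p) + 1"
  have "2 * real_of_int (x k) - b = sqrt (b\<^sup>2 + 8 * excess \<alpha> x (k - 1))"
    using eq by (simp add: xbound_def Let_def b_def p_def)
  \<comment> \<open>Since \<open>sqrt\<close> is an odd function on all reals, its square is the
    radicand only when that is nonnegative; the sign of the excess ensures this.\<close>
  then have "(2 * real_of_int (x k) - b)\<^sup>2 = b\<^sup>2 + 8 * excess \<alpha> x (k - 1)"
    using assms(2) by simp
  then have "real_of_int ((p + x k) * (2 * \<alpha> k + 1 - (p + x k))) = real_of_int (2 * (\<alpha> k * p - q))"
    unfolding excess_def b_def p_def[symmetric] q_def[symmetric]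
    by (simp add: power2_eq_square field_simps)
  then have "(p + x k) * (2 * \<alpha> k + 1 - (p + x k)) = 2 * (\<alpha> k * p - q)"
    by (simp only: of_int_eq_iff)
  moreover have "psum x k = p + x k"
    using \<open>1 \<le> k\<close> by (cases k) (simp_all add: p_def psum_def)
  moreover have "(\<Sum>i=1..k-1. (\<alpha> k - \<alpha> i) * x i) = \<alpha> k * p - q"
    by (simp add: p_def q_def psum_def qsum_def sum_distrib_left sum_subtractf left_diff_distrib)
  ultimately show ?thesis by simp
qed

theorem theorem2p4:
  fixes n :: nat and \<alpha> x :: "nat \<Rightarrow> int"
  assumes "n \<ge> 2"
    and "0 \<le> \<alpha> 1"
    and "strict_mono_on {1..n} \<alpha>"
    and "\<And>k. k \<in> {1..n} \<Longrightarrow> 0 < x k"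
    and "\<And>k. k \<in> {1..n} \<Longrightarrow> 0 \<le> excess \<alpha> x (k - 1)"
    and "\<And>k. k \<in> {1..n} \<Longrightarrow> 1 \<le> x k \<and> real_of_int (x k) \<le> xbound \<alpha> x k"
    and "real_of_int (x n) = xbound \<alpha> x n"
  shows "\<exists>f::int. 0 \<le> f \<and> real_of_int f \<le> (2 * real_of_int (\<alpha> n) + 1) / 2 \<and>
           (2 * \<alpha> n + 1 - 2 * f) * f = (\<Sum>i=1..n-1. (\<alpha> n - \<alpha> i) * x i)"
proof -
  have "0 < psum x n"
    unfolding psum_def using assms(1,4) by (intro sum_pos) auto
  \<comment> \<open>Monotonicity of \<open>\<alpha>\<close> makes every weight positive; this is the
    sign condition on \<open>S\<close> in \<open>half_of_even_factor\<close>.\<close>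
  moreover have "0 \<le> (\<Sum>i=1..n-1. (\<alpha> n - \<alpha> i) * x i)"
  proof (intro sum_nonneg mult_nonneg_nonneg)
    fix i assume i: "i \<in> {1..n-1}"
    then have "\<alpha> i < \<alpha> n"
      using assms(1) by (intro strict_mono_onD[OF assms(3)]) auto
    then show "0 \<le> \<alpha> n - \<alpha> i" by simp
    show "0 \<le> x i" using i by (intro less_imp_le assms(4)) auto
  qed
  moreover have "psum x n * (2 * \<alpha> n + 1 - psum x n) = 2 * (\<Sum>i=1..n-1. (\<alpha> n - \<alpha> i) * x i)"
    using assms(1,5,7) by (intro xbound_quadratic) auto
  ultimately obtain f where f: "0 \<le> f" "2 * f \<le> 2 * \<alpha> n + 1"
    "(2 * \<alpha> n + 1 - 2 * f) * f = (\<Sum>i=1..n-1. (\<alpha> n - \<alpha> i) * x i)"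
    using half_of_even_factor by blast
  \<comment> \<open>The right side of the bound is odd, so over the integers it sharpens to
    \<open>f \<le> \<alpha> n\<close>.\<close>
  have "f \<le> \<alpha> n"
    using f(2) by presburger
  then have "real_of_int f \<le> (2 * real_of_int (\<alpha> n) + 1) / 2"
    by simp
  with f show ?thesis by blast
qed

end
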